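(* For every connected weighted graph $(G,\mathbf{w})$: (1) $c_{\lambda}(G,\mathbf{w}) \geq \lambda\, \mathrm{diam}_\mathbf{w}(G)$ for every positive integer $\lambda$; (2) $c_{\lambda}(G,\mathbf{w}) \leq 2\lambda\, \mathrm{diam}_\mathbf{w}(G)$ for some sufficiently large positive integer $\lambda$.
   Context: A weighted graph $(G,\mathbf{w})$ is a finite simple graph with positive integer edge weights that is weight-minimal: every edge is a shortest path between its endpoints. $d_\mathbf{w}(u,v)$ is the minimum total weight of a $(u,v)$-path and $\mathrm{diam}_\mathbf{w}(G)=\max_{u,v}d_\mathbf{w}(u,v)$. For a positive integer $\lambda$, $c_\lambda(G,\mathbf{w})$ is the minimum $m$ such that there is $f:V(G)\to\{0,1\}^m$ with $\lambda\, d_\mathbf{w}(u,v)\le d_H(f(u),f(v))$ for all $u,v\in V(G)$, where $d_H$ is Hamming distance. *)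

theory Defs
  imports "Graph_Theory.Pair_Digraph" "Graph_Theory.Digraph_Component"
begin

definition wdist :: "'a pair_pre_digraph \<Rightarrow> ('a \<times> 'a \<Rightarrow> nat) \<Rightarrow> 'a \<Rightarrow> 'a \<Rightarrow> nat" where
  "wdist G w u v = Min {sum_list (map w p) | p. pre_digraph.apath (with_proj G) u p v}"

text \<open>
  An undirected edge is represented by a pair of opposite arcs, so the weight function must agree on
  the two. The last assumption is weight-minimality: every edge is a shortest path.
\<close>

locale weighted_graph = pair_graph G for G :: "'a pair_pre_digraph" +
  fixes w :: "'a \<times> 'a \<Rightarrow> nat"
  assumes weight_sym: "(u, v) \<in> parcs G \<Longrightarrow> w (u, v) = w (v, u)"
    and weight_pos: "(u, v) \<in> parcs G \<Longrightarrow> 0 < w (u, v)"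
    and weight_minimal: "(u, v) \<in> parcs G \<Longrightarrow> w (u, v) = wdist G w u v"

definition wdiam :: "'a pair_pre_digraph \<Rightarrow> ('a \<times> 'a \<Rightarrow> nat) \<Rightarrow> nat" where
  "wdiam G w = Max {wdist G w u v | u v. u \<in> pverts G \<and> v \<in> pverts G}"

text \<open>Only meant for lists of equal length; words in $\{0,1\}^m$ are Boolean lists of length $m$.\<close>

definition hamming_dist :: "'b list \<Rightarrow> 'b list \<Rightarrow> nat" where
  "hamming_dist xs ys = card {i. i < length xs \<and> xs ! i \<noteq> ys ! i}"

definition hamming_embedding ::
    "'a pair_pre_digraph \<Rightarrow> ('a \<times> 'a \<Rightarrow> nat) \<Rightarrow> nat \<Rightarrow> nat \<Rightarrow> ('a \<Rightarrow> bool list) \<Rightarrow> bool" where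
  "hamming_embedding G w lam m f \<longleftrightarrow>
     (\<forall>v \<in> pverts G. length (f v) = m) \<and>
     (\<forall>u \<in> pverts G. \<forall>v \<in> pverts G. lam * wdist G w u v \<le> hamming_dist (f u) (f v))"

definition c_lambda :: "nat \<Rightarrow> 'a pair_pre_digraph \<Rightarrow> ('a \<times> 'a \<Rightarrow> nat) \<Rightarrow> nat" where
  "c_lambda lam G w = (LEAST m. \<exists>f. hamming_embedding G w lam m f)"

end

theory Submission
  imports Defs
begin

text \<open>
  For the lower bound, a pair of vertices at distance \<open>diam\<close> forces \<open>\<lambda> diam\<close> differing
  coordinates. For the upper bound, list all \<open>2\<^sup>n\<close> subsets of the vertex set, each of them
  \<open>K\<close> times, and send a vertex to the vector of its membership bits: any two distinct vertices
  are separated by exactly half of the subsets. With \<open>K = k diam\<close> and \<open>\<lambda> = 2\<^sup>n\<^sup>-\<^sup>1 k\<close> this has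
  length \<open>2 \<lambda> diam\<close> and all Hamming distances between distinct vertices are \<open>\<lambda> diam\<close>.
\<close>

lemma hamming_dist_le_length: "hamming_dist xs ys \<le> length xs"
proof -
  have "hamming_dist xs ys \<le> card {..<length xs}"
    unfolding hamming_dist_def by (intro card_mono) auto
  then show ?thesis by simp
qed

text \<open>A subset of \<open>V - {u}\<close> becomes a separating set by keeping it if it contains
  \<open>v\<close> and adding \<open>u\<close> otherwise; deleting \<open>u\<close> undoes this, so
  the map is injective.\<close>

lemma card_separating_subsets:
  assumes "finite V" "u \<in> V" "v \<in> V" "u \<noteq> v"
  shows "2 ^ (card V - 1) \<le> card {A \<in> Pow V. (u \<in> A) \<noteq> (v \<in> A)}"
proof -
  let ?g = "\<lambda>B. if v \<in> B then B else insert u B"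
  have "inj_on ?g (Pow (V - {u}))"
    by (rule inj_on_inverseI[where g = "\<lambda>A. A - {u}"]) auto
  moreover have "?g ` Pow (V - {u}) \<subseteq> {A \<in> Pow V. (u \<in> A) \<noteq> (v \<in> A)}"
    using assms by (auto split: if_splits)
  ultimately have "card (Pow (V - {u})) \<le> card {A \<in> Pow V. (u \<in> A) \<noteq> (v \<in> A)}"
    by (rule card_inj_on_le) (simp add: assms(1))
  then show ?thesis
    using assms by (simp add: card_Pow)
qed

lemma ex_separating_code:
  assumes "finite V"
  obtains f :: "'a \<Rightarrow> bool list" where "\<And>v. length (f v) = K * 2 ^ card V"
    and "\<And>u v. \<lbrakk>u \<in> V; v \<in> V; u \<noteq> v\<rbrakk> \<Longrightarrow> K * 2 ^ (card V - 1) \<le> hamming_dist (f u) (f v)"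
proof -
  let ?I = "Pow V \<times> {..<K}"
  let ?m = "K * 2 ^ card V"
  have "finite ?I" "card ?I = ?m"
    using assms by (simp_all add: card_cartesian_product card_Pow)
  then obtain h where h: "bij_betw h {0..<?m} ?I"
    using ex_bij_betw_nat_finite by metis
  define f where "f v = map (\<lambda>i. v \<in> fst (h i)) [0..<?m]" for v
  show thesis
  proof
    show "length (f v) = ?m" for v
      by (simp add: f_def)
    fix u v assume uv: "u \<in> V" "v \<in> V" "u \<noteq> v"
    let ?S = "{A \<in> Pow V. (u \<in> A) \<noteq> (v \<in> A)}"
    let ?D = "{i. i < length (f u) \<and> f u ! i \<noteq> f v ! i}"
    \<comment> \<open>Since \<open>h\<close> enumerates all pairs of a subset and a copy number,
      each copy of a separating subset sits at a coordinate where the two words differ.\<close>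
    have "?S \<times> {..<K} \<subseteq> h ` ?D"
    proof
      fix x assume x: "x \<in> ?S \<times> {..<K}"
      then have "x \<in> h ` {0..<?m}"
        using h by (auto simp: bij_betw_def)
      then obtain i where "i < ?m" "x = h i" by auto
      with x show "x \<in> h ` ?D"
        by (auto simp: f_def)
    qed
    then have "card (?S \<times> {..<K}) \<le> card ?D"
      by (intro surj_card_le) auto
    then have "K * card ?S \<le> hamming_dist (f u) (f v)"
      by (simp add: hamming_dist_def card_cartesian_product mult.commute)
    then show "K * 2 ^ (card V - 1) \<le> hamming_dist (f u) (f v)"
      using card_separating_subsets[OF assms uv] by (meson le_trans mult_le_mono2)
  qed
qed

context pair_fin_digraph
begin

lemma finite_wdist_values: "finite {wdist G w u v | u v. u \<in> pverts G \<and> v \<in> pverts G}"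
  by (rule finite_image_set2) simp_all

lemma wdist_le_wdiam:
  assumes "u \<in> pverts G" "v \<in> pverts G"
  shows "wdist G w u v \<le> wdiam G w"
  unfolding wdiam_def using assms by (intro Max_ge[OF finite_wdist_values]) auto

lemma wdiam_attained:
  assumes "pverts G \<noteq> {}"
  obtains u v where "u \<in> pverts G" "v \<in> pverts G" "wdist G w u v = wdiam G w"
proof -
  have "wdiam G w \<in> {wdist G w u v | u v. u \<in> pverts G \<and> v \<in> pverts G}"
    unfolding wdiam_def using assms by (intro Max_in[OF finite_wdist_values]) auto
  then show thesis using that by auto
qed

lemma wdist_same:
  assumes "u \<in> pverts G"
  shows "wdist G w u u = 0"
proof -
  \<comment> \<open>A nonempty \<open>apath\<close> has distinct ends, so the minimum is taken over
    \<open>{0}\<close>.\<close>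
  have "apath u p u \<longleftrightarrow> p = []" for p
    using assms apath_nonempty_ends[of u p u] by (cases "p = []") (simp_all add: apath_Nil_iff, blast)
  then show ?thesis by (simp add: wdist_def)
qed

text \<open>The bound on \<open>lam\<close> is an inequality to serve two purposes:
  \<open>k = lam\<close> shows that some embedding exists, while equality gives the length for the
  upper bound.\<close>

lemma ex_hamming_embedding:
  assumes "lam \<le> k * 2 ^ (card (pverts G) - 1)"
  shows "\<exists>f. hamming_embedding G w lam (k * wdiam G w * 2 ^ card (pverts G)) f"
proof -
  let ?V = "pverts G" and ?D = "wdiam G w"
  obtain f :: "'a \<Rightarrow> bool list" where len: "\<And>v. length (f v) = k * ?D * 2 ^ card ?V"
    and sep: "\<And>u v. \<lbrakk>u \<in> ?V; v \<in> ?V; u \<noteq> v\<rbrakk> \<Longrightarrow>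
      k * ?D * 2 ^ (card ?V - 1) \<le> hamming_dist (f u) (f v)"
    using ex_separating_code[of ?V "k * ?D"] by auto
  have "lam * wdist G w u v \<le> hamming_dist (f u) (f v)" if uv: "u \<in> ?V" "v \<in> ?V" for u v
  proof (cases "u = v")
    case True
    then show ?thesis using uv by (simp add: wdist_same)
  next
    case False
    have "lam * wdist G w u v \<le> k * 2 ^ (card ?V - 1) * ?D"
      by (intro mult_le_mono assms wdist_le_wdiam uv)
    also have "\<dots> \<le> hamming_dist (f u) (f v)"
      using sep[OF uv False] by (simp add: mult_ac)
    finally show ?thesis .
  qed
  then show ?thesis
    unfolding hamming_embedding_def using len by blast
qed

text \<open>The \<open>LEAST\<close> in \<open>c_lambda\<close> is attained because some length
  admits an embedding.\<close>

lemma ex_hamming_embedding_c_lambda: "\<exists>f. hamming_embedding G w lam (c_lambda lam G w) f"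
  unfolding c_lambda_def
  by (rule LeastI_ex) (use ex_hamming_embedding[of lam lam w] in auto)

end

theorem theorem3:
  fixes G :: "'a pair_pre_digraph" and w :: "'a \<times> 'a \<Rightarrow> nat"
  assumes "weighted_graph G w" and "connected (with_proj G)"
  shows "(\<forall>lam::nat. 0 < lam \<longrightarrow> lam * wdiam G w \<le> c_lambda lam G w) \<and>
         (\<forall>N::nat. \<exists>lam\<ge>N. 0 < lam \<and> c_lambda lam G w \<le> 2 * lam * wdiam G w)"
proof -
  interpret weighted_graph G w by (fact assms(1))
  \<comment> \<open>Connectedness includes having a vertex, so the diameter is a maximum over a
    nonempty set.\<close>
  have ne: "pverts G \<noteq> {}"
    using assms(2) by (auto simp: connected_def strongly_connected_def)
  have "lam * wdiam G w \<le> c_lambda lam G w" for lam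
  proof -
    obtain f where f: "hamming_embedding G w lam (c_lambda lam G w) f"
      using ex_hamming_embedding_c_lambda by blast
    obtain u v where "u \<in> pverts G" "v \<in> pverts G" "wdist G w u v = wdiam G w"
      using wdiam_attained[OF ne] .
    with f show ?thesis
      unfolding hamming_embedding_def by (metis hamming_dist_le_length le_trans)
  qed
  moreover have "\<exists>lam\<ge>N. 0 < lam \<and> c_lambda lam G w \<le> 2 * lam * wdiam G w" for N
  proof (intro exI conjI)
    let ?n = "card (pverts G)"
    \<comment> \<open>This is the largest value allowed by \<open>ex_hamming_embedding\<close> for
      \<open>k = Suc N\<close>; the successor keeps it positive when \<open>N = 0\<close>.\<close>
    let ?lam = "Suc N * 2 ^ (?n - 1)"
    have "Suc N * 1 \<le> ?lam"
      by (intro mult_le_mono2) simp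
    then show "N \<le> ?lam" "0 < ?lam"
      by simp_all
    \<comment> \<open>For \<open>?n = 0\<close> the truncated \<open>?n - 1\<close> would break the
      halving of \<open>2 ^ ?n\<close>.\<close>
    have "0 < ?n"
      using ne by (simp add: card_gt_0_iff)
    then have "(2::nat) ^ ?n = 2 * 2 ^ (?n - 1)"
      by (cases ?n) simp_all
    then have "Suc N * wdiam G w * 2 ^ ?n = 2 * ?lam * wdiam G w"
      by (simp only: mult_ac)
    moreover have "c_lambda ?lam G w \<le> Suc N * wdiam G w * 2 ^ ?n"
      unfolding c_lambda_def by (rule Least_le) (rule ex_hamming_embedding, rule le_refl)
    ultimately show "c_lambda ?lam G w \<le> 2 * ?lam * wdiam G w"
      by simp
  qed
  ultimately show ?thesis by blast
qed

end
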